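(* Let $X$ and $Y$ be Banach spaces such that $Y$ contains an isometric copy of $\ell_q$ for some $1\leq q<\infty$, and let $x_0\in X$ with $\|x_0\|_X=1$. Then the set $$\mathcal{NA}^{x_0}(X;Y)=\left\{T\in\mathcal{L}(X;Y):\|T x_0\|_Y=\|T\|_{\mathcal{L}(X;Y)}\right\}$$ is lineable in $\mathcal{L}(X;Y)$.
   Context: $X$ and $Y$ are Banach spaces over the same scalar field. $\mathcal{L}(X;Y)$ is the space of all bounded linear operators from $X$ to $Y$ with the operator norm $\|T\|_{\mathcal{L}(X;Y)}=\sup\{\|T(x)\|_Y:\|x\|_X=1\}$. "$Y$ contains an isometric copy of $\ell_q$" means there is a linear isometric embedding $\ell_q\to Y$, where $\ell_q$ is the usual space of $q$-summable scalar sequences. A subset $A$ of an infinite-dimensional vector space $V$ is lineable (in $V$) if $A\cup\{0\}$ contains an infinite-dimensional linear subspace of $V$. *)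

theory Defs
  imports "HOL-Analysis.Analysis"
begin

text \<open>The scalar field is the reals or the complex numbers. Since the norm of a
  \<^class>\<open>real_normed_field\<close> is multiplicative, the algebraic description below also fixes the
  absolute value, so every instance is isometrically isomorphic to \<^typ>\<open>real\<close> or \<^typ>\<open>complex\<close>.\<close>

class real_or_complex = real_normed_field +
  assumes real_or_complex:
    "(\<forall>z. \<exists>a. z = a *\<^sub>R 1) \<or>
     (\<exists>i. i * i = - 1 \<and> (\<forall>z. \<exists>a b. z = a *\<^sub>R 1 + b *\<^sub>R i))"

instance real :: real_or_complex
  by standard auto

instance complex :: real_or_complex
proof
  have "\<forall>z::complex. \<exists>a b. z = a *\<^sub>R 1 + b *\<^sub>R \<i>"
    by (auto simp: complex_eq_iff)
  then show "(\<forall>z::complex. \<exists>a. z = a *\<^sub>R 1) \<or>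
     (\<exists>i::complex. i * i = - 1 \<and> (\<forall>z. \<exists>a b. z = a *\<^sub>R 1 + b *\<^sub>R i))"
    using i_squared by blast
qed

text \<open>The class \<^class>\<open>banach\<close> supplies the complete norm and the underlying real structure;
  \<open>scale\<close> is multiplication by scalars from the field \<open>'k\<close>, extending the real one.\<close>

locale banach_space_over = vector_space scale
  for scale :: "'k::real_or_complex \<Rightarrow> 'x::banach \<Rightarrow> 'x" +
  assumes scale_of_real: "scale (of_real r) x = r *\<^sub>R x"
    and norm_scale: "norm (scale c x) = norm c * norm x"
begin

lemma bounded_linear_scale: "bounded_linear (scale c)"
proof (rule bounded_linear_intro)
  show "scale c (x + y) = scale c x + scale c y" for x y
    by (rule scale_right_distrib)
  show "scale c (r *\<^sub>R x) = r *\<^sub>R scale c x" for r x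
    by (metis scale_of_real scale_left_commute)
  show "norm (scale c x) \<le> norm x * norm c" for x
    by (simp add: norm_scale)
qed

end

lemma banach_space_over_scaleR: "banach_space_over ((*\<^sub>R) :: real \<Rightarrow> 'x::banach \<Rightarrow> 'x)"
  by unfold_locales (auto simp: algebra_simps)

text \<open>Elements of \<^typ>\<open>'x \<Rightarrow>\<^sub>L 'y\<close> are only real-linear, so linearity over \<open>'k\<close> is imposed separately.
  The norm on this type is the operator norm.\<close>

definition bounded_operators ::
  "('k::real_or_complex \<Rightarrow> 'x::banach \<Rightarrow> 'x) \<Rightarrow> ('k \<Rightarrow> 'y::banach \<Rightarrow> 'y) \<Rightarrow> ('x \<Rightarrow>\<^sub>L 'y) set"
  where "bounded_operators sX sY = {T. Vector_Spaces.linear sX sY (blinfun_apply T)}"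

definition blinfun_scale ::
  "('k::real_or_complex \<Rightarrow> 'y::banach \<Rightarrow> 'y) \<Rightarrow> 'k \<Rightarrow> ('x::banach \<Rightarrow>\<^sub>L 'y) \<Rightarrow> ('x \<Rightarrow>\<^sub>L 'y)"
  where "blinfun_scale sY c T = Blinfun (\<lambda>x. sY c (blinfun_apply T x))"

lemma blinfun_apply_blinfun_scale:
  assumes "banach_space_over sY"
  shows "blinfun_apply (blinfun_scale sY c T) x = sY c (blinfun_apply T x)"
proof -
  interpret banach_space_over sY by fact
  have "bounded_linear (\<lambda>x. sY c (blinfun_apply T x))"
    by (rule bounded_linear_compose[OF bounded_linear_scale blinfun.bounded_linear_right])
  then show ?thesis
    by (simp add: blinfun_scale_def bounded_linear_Blinfun_apply)
qed

lemma vector_space_blinfun_scale: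
  assumes "banach_space_over sY"
  shows "vector_space (blinfun_scale sY :: _ \<Rightarrow> ('x::banach \<Rightarrow>\<^sub>L _) \<Rightarrow> _)"
proof -
  interpret banach_space_over sY by fact
  show ?thesis
    by unfold_locales
      (auto intro!: blinfun_eqI simp: blinfun_apply_blinfun_scale[OF assms] blinfun.bilinear_simps
        scale_right_distrib scale_left_distrib)
qed

lemma subspace_bounded_operators:
  assumes X: "banach_space_over sX" and Y: "banach_space_over sY"
  shows "module.subspace (blinfun_scale sY) (bounded_operators sX sY)"
proof -
  interpret X: banach_space_over sX by fact
  interpret Y: banach_space_over sY by fact
  interpret L: vector_space "blinfun_scale sY :: 'a \<Rightarrow> ('b \<Rightarrow>\<^sub>L 'c) \<Rightarrow> _"
    by (rule vector_space_blinfun_scale[OF Y])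
  show ?thesis
  proof (rule L.subspaceI)
    show "0 \<in> bounded_operators sX sY"
      by (simp add: bounded_operators_def Vector_Spaces.linear_iff X.vector_space_axioms Y.vector_space_axioms)
  next
    fix S T assume "S \<in> bounded_operators sX sY" and "T \<in> bounded_operators sX sY"
    then show "S + T \<in> bounded_operators sX sY"
      by (simp add: bounded_operators_def Vector_Spaces.linear_iff X.vector_space_axioms Y.vector_space_axioms blinfun.add_left blinfun.add_right
          Y.scale_right_distrib)
  next
    fix c T assume "T \<in> bounded_operators sX sY"
    then show "blinfun_scale sY c T \<in> bounded_operators sX sY"
      by (simp add: bounded_operators_def Vector_Spaces.linear_iff X.vector_space_axioms Y.vector_space_axioms blinfun_apply_blinfun_scale[OF Y]
          Y.scale_right_distrib Y.scale_left_commute[of c])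
  qed
qed

definition norm_attaining_at ::
  "('k::real_or_complex \<Rightarrow> 'x::banach \<Rightarrow> 'x) \<Rightarrow> ('k \<Rightarrow> 'y::banach \<Rightarrow> 'y) \<Rightarrow> 'x \<Rightarrow> ('x \<Rightarrow>\<^sub>L 'y) set"
  where "norm_attaining_at sX sY x0 =
    {T \<in> bounded_operators sX sY. norm (blinfun_apply T x0) = norm T}"

definition ell :: "real \<Rightarrow> (nat \<Rightarrow> 'k::real_or_complex) set"
  where "ell q = {a. summable (\<lambda>n. norm (a n) powr q)}"

definition ell_norm :: "real \<Rightarrow> (nat \<Rightarrow> 'k::real_or_complex) \<Rightarrow> real"
  where "ell_norm q a = (\<Sum>n. norm (a n) powr q) powr (1 / q)"

definition contains_isometric_copy_of_ell ::
  "('k::real_or_complex \<Rightarrow> 'y::banach \<Rightarrow> 'y) \<Rightarrow> real \<Rightarrow> bool"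
  where "contains_isometric_copy_of_ell sY q \<longleftrightarrow>
    (\<exists>J :: (nat \<Rightarrow> 'k) \<Rightarrow> 'y.
      (\<forall>a \<in> ell q. \<forall>b \<in> ell q. J (\<lambda>n. a n + b n) = J a + J b) \<and>
      (\<forall>c. \<forall>a \<in> ell q. J (\<lambda>n. c * a n) = sY c (J a)) \<and>
      (\<forall>a \<in> ell q. norm (J a) = ell_norm q a))"

definition infinite_dimensional ::
  "('k::field \<Rightarrow> 'v::ab_group_add \<Rightarrow> 'v) \<Rightarrow> 'v set \<Rightarrow> bool"
  where "infinite_dimensional s W \<longleftrightarrow> (\<nexists>B. finite B \<and> module.span s B = W)"

text \<open>The space \<open>V\<close> is a subspace of the ambient type. It is automatically infinite-dimensional
  as soon as it contains some \<open>W\<close> as below.\<close>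

definition lineable ::
  "('k::field \<Rightarrow> 'v::ab_group_add \<Rightarrow> 'v) \<Rightarrow> 'v set \<Rightarrow> 'v set \<Rightarrow> bool"
  where "lineable s V A \<longleftrightarrow> vector_space s \<and> module.subspace s V \<and> A \<subseteq> V \<and>
    (\<exists>W. module.subspace s W \<and> infinite_dimensional s W \<and> W \<subseteq> A \<union> {0})"

end

theory Submission
  imports Defs
begin

text \<open>By Hahn--Banach there is a scalar-linear functional \<open>\<phi>\<close> of norm one with \<open>|\<phi> x0| = 1\<close>.
  Each rank-one operator \<open>x \<mapsto> \<phi> x \<cdot> y\<close> attains its norm \<open>\<parallel>y\<parallel>\<close> at \<open>x0\<close>, and these
  operators form a subspace isomorphic to \<open>Y\<close>, which is infinite-dimensional because it contains
  the images of the unit vectors of \<open>\<ell>\<^sub>q\<close>.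

  For Hahn--Banach itself, a sublinear functional that is minimal in the pointwise order is linear,
  and minimal ones exist by Zorn's lemma. The real functional so obtained is complexified as
  \<open>x \<mapsto> f x - i f (i x)\<close>.\<close>

section \<open>The Hahn--Banach theorem for sublinear functionals\<close>

definition sublinear :: "('a::real_vector \<Rightarrow> real) \<Rightarrow> bool"
  where "sublinear p \<longleftrightarrow>
    (\<forall>x y. p (x + y) \<le> p x + p y) \<and> (\<forall>r x. 0 \<le> r \<longrightarrow> p (r *\<^sub>R x) = r * p x)"

lemma sublinear_add: "sublinear p \<Longrightarrow> p (x + y) \<le> p x + p y"
  by (simp add: sublinear_def)

lemma sublinear_scaleR: "sublinear p \<Longrightarrow> 0 \<le> r \<Longrightarrow> p (r *\<^sub>R x) = r * p x"
  by (simp add: sublinear_def)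

lemma sublinear_zero: "sublinear p \<Longrightarrow> p 0 = 0"
  using sublinear_scaleR[of p 0 0] by simp

lemma sublinear_ge: "sublinear p \<Longrightarrow> - p (- x) \<le> p x"
  using sublinear_add[of p x "- x"] sublinear_zero[of p] by simp

text \<open>Applying \<open>le\<close> to the scalar \<open>inverse r\<close> and the vector
  \<open>r *\<^sub>R x\<close> reverses the inequality, so one direction for positive scalars
  suffices. The scalar zero is covered by the value at 0.\<close>

lemma sublinearI:
  assumes "\<And>x y. p (x + y) \<le> p x + p y"
    and "p 0 = 0"
    and le: "\<And>r x. 0 < r \<Longrightarrow> p (r *\<^sub>R x) \<le> r * p x"
  shows "sublinear p"
  unfolding sublinear_def
proof (intro conjI allI impI)
  fix r :: real and x assume "0 \<le> r"
  show "p (r *\<^sub>R x) = r * p x"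
  proof (cases "r = 0")
    case False
    with \<open>0 \<le> r\<close> have r: "0 < r" by simp
    from le[of "inverse r" "r *\<^sub>R x"] r have "r * p x \<le> p (r *\<^sub>R x)"
      by (simp add: field_simps)
    with le[OF r] show ?thesis by (simp add: order_antisym)
  qed (simp add: assms)
qed (rule assms)

lemma sublinear_norm: "sublinear norm"
  by (simp add: sublinear_def norm_triangle_ineq)

text \<open>A pointwise infimum of sublinear functionals need not be subadditive. In a chain,
  however, any two members \<open>q\<close> and \<open>q'\<close> have a common lower bound
  \<open>m\<close> in \<open>C\<close>, and subadditivity of \<open>m\<close> bounds the infimum at
  \<open>x + y\<close> by \<open>q x + q' y\<close>.\<close>

lemma sublinear_INF_chain:
  assumes "C \<noteq> {}" and sub: "\<And>q. q \<in> C \<Longrightarrow> sublinear q"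
    and bdd: "\<And>x. bdd_below ((\<lambda>q. q x) ` C)"
    and chain: "\<And>q q'. q \<in> C \<Longrightarrow> q' \<in> C \<Longrightarrow> q \<le> q' \<or> q' \<le> q"
  shows "sublinear (\<lambda>x. INF q\<in>C. q x)"
proof (rule sublinearI)
  have low: "(INF q\<in>C. q x) \<le> q x" if "q \<in> C" for q x
    by (rule cINF_lower[OF bdd that])
  show "(INF q\<in>C. q (0::'a)) = 0"
    using sub assms(1) by (simp add: sublinear_zero cong: INF_cong_simp)
  show "(INF q\<in>C. q (x + y)) \<le> (INF q\<in>C. q x) + (INF q\<in>C. q y)" for x y
  proof -
    have sum: "(INF q\<in>C. q (x + y)) \<le> q x + q' y" if q: "q \<in> C" "q' \<in> C" for q q'
    proof -
      obtain m where m: "m \<in> C" "m \<le> q" "m \<le> q'"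
        using chain[OF q] q by blast
      have "(INF q\<in>C. q (x + y)) \<le> m x + m y"
        using low[OF m(1)] sublinear_add[OF sub[OF m(1)]] by (rule order_trans)
      also have "\<dots> \<le> q x + q' y"
        using m by (intro add_mono) (simp_all add: le_fun_def)
      finally show ?thesis .
    qed
    have "(INF q\<in>C. q (x + y)) - q x \<le> (INF q\<in>C. q y)" if "q \<in> C" for q
      using assms(1) by (intro cINF_greatest) (use sum[OF that] in \<open>auto simp: algebra_simps\<close>)
    then have "(INF q\<in>C. q (x + y)) - (INF q\<in>C. q y) \<le> (INF q\<in>C. q x)"
      using assms(1) by (intro cINF_greatest) (auto simp: algebra_simps)
    then show ?thesis by simp
  qed
  show "(INF q\<in>C. q (r *\<^sub>R x)) \<le> r * (INF q\<in>C. q x)" if "0 < r" for r x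
  proof -
    have "(INF q\<in>C. q (r *\<^sub>R x)) / r \<le> q x" if "q \<in> C" for q
      using low[OF that, of "r *\<^sub>R x"] \<open>0 < r\<close> sub[OF that]
      by (simp add: sublinear_scaleR field_simps)
    then have "(INF q\<in>C. q (r *\<^sub>R x)) / r \<le> (INF q\<in>C. q x)"
      using assms(1) by (intro cINF_greatest)
    then show ?thesis using \<open>0 < r\<close> by (simp add: field_simps)
  qed
qed

text \<open>Infimal convolution of \<open>p\<close> with the ray through \<open>- z\<close>, on which the value at \<open>- z\<close> is
  forced down to \<open>- p z\<close>.\<close>

lemma sublinear_decrease:
  fixes p :: "'a::real_vector \<Rightarrow> real"
  assumes "sublinear p"
  obtains q where "sublinear q" "q \<le> p" "\<And>x. q x \<le> p (x + z) - p z"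
proof -
  define g where "g t x = p (x + t *\<^sub>R z) - t * p z" for t x
  define q where "q x = (INF t\<in>{0..}. g t x)" for x
  \<comment> \<open>The bound does not depend on \<open>t\<close>, so the infimum defining
    \<open>q\<close> is finite.\<close>
  have lower: "- p (- x) \<le> g t x" if "0 \<le> t" for t x
    using sublinear_add[OF assms, of "x + t *\<^sub>R z" "- x"] sublinear_scaleR[OF assms that, of z]
    by (simp add: g_def)
  have low: "q x \<le> g t x" if "0 \<le> t" for t x
    unfolding q_def
    by (rule cINF_lower) (use that lower in \<open>auto intro!: bdd_belowI2[where m = "- p (- x)"]\<close>)
  have greatest: "m \<le> q x" if "\<And>t. 0 \<le> t \<Longrightarrow> m \<le> g t x" for m x
    unfolding q_def by (rule cINF_greatest) (use that in auto)
  have "sublinear q"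
  proof (rule sublinearI)
    have "q 0 \<le> 0" using low[of 0 0] sublinear_zero[OF assms] by (simp add: g_def)
    moreover have "0 \<le> q 0"
      by (rule greatest) (use lower[of _ 0] sublinear_zero[OF assms] in auto)
    ultimately show "q 0 = 0" by simp
    show "q (x + y) \<le> q x + q y" for x y
    proof -
      have sum: "q (x + y) \<le> g s x + g t y" if "0 \<le> s" "0 \<le> t" for s t
      proof -
        \<comment> \<open>The ray is closed under addition: parameters \<open>s\<close> for
          \<open>x\<close> and \<open>t\<close> for \<open>y\<close> combine to
          \<open>s + t\<close>.\<close>
        have "q (x + y) \<le> g (s + t) (x + y)" using that by (intro low) simp
        also have "\<dots> \<le> g s x + g t y"
          using sublinear_add[OF assms, of "x + s *\<^sub>R z" "y + t *\<^sub>R z"]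
          by (simp add: g_def algebra_simps)
        finally show ?thesis .
      qed
      have "q (x + y) - g s x \<le> q y" if s: "0 \<le> s" for s
      proof (rule greatest)
        show "q (x + y) - g s x \<le> g t y" if "0 \<le> t" for t
          using sum[OF s that] by linarith
      qed
      then have "q (x + y) - q y \<le> q x"
        by (intro greatest) (auto simp: algebra_simps)
      then show ?thesis by simp
    qed
    show "q (r *\<^sub>R x) \<le> r * q x" if "0 < r" for r x
    proof -
      have "q (r *\<^sub>R x) / r \<le> g t x" if "0 \<le> t" for t
      proof -
        have "q (r *\<^sub>R x) \<le> g (r * t) (r *\<^sub>R x)" using that \<open>0 < r\<close> by (intro low) simp
        also have "\<dots> = r * g t x"
          using sublinear_scaleR[OF assms, of r "x + t *\<^sub>R z"] \<open>0 < r\<close>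
          by (simp add: g_def algebra_simps)
        finally show ?thesis using \<open>0 < r\<close> by (simp add: field_simps)
      qed
      then have "q (r *\<^sub>R x) / r \<le> q x" by (rule greatest)
      then show ?thesis using \<open>0 < r\<close> by (simp add: field_simps)
    qed
  qed
  moreover have "q \<le> p" using low[of 0] by (simp add: le_fun_def g_def)
  moreover have "q x \<le> p (x + z) - p z" for x using low[of 1 x] by (simp add: g_def)
  ultimately show thesis by (rule that)
qed

text \<open>Minimality forces the functional from \<open>sublinear_decrease\<close> with
  \<open>z = y\<close> to be \<open>p\<close> itself. Its bound then reads
  \<open>p x \<le> p (x + y) - p y\<close>, the inequality missing for additivity.\<close>

lemma minimal_sublinear_imp_linear:
  fixes p :: "'a::real_vector \<Rightarrow> real"
  assumes "sublinear p" and min: "\<And>q. sublinear q \<Longrightarrow> q \<le> p \<Longrightarrow> q = p"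
  shows "linear p"
proof -
  have add: "p (x + y) = p x + p y" for x y
  proof -
    obtain q where "sublinear q" "q \<le> p" "q x \<le> p (x + y) - p y"
      using sublinear_decrease[OF assms(1)] by metis
    with min sublinear_add[OF assms(1), of x y] show ?thesis by fastforce
  qed
  have neg: "p (- x) = - p x" for x
    using add[of x "- x"] sublinear_zero[OF assms(1)] by simp
  show ?thesis
  proof (rule linearI)
    fix r x
    show "p (r *\<^sub>R x) = r *\<^sub>R p x"
    proof (cases "0 \<le> r")
      case False
      then show ?thesis
        using sublinear_scaleR[OF assms(1), of "- r" x] neg[of "r *\<^sub>R x"] by simp
    qed (simp add: sublinear_scaleR[OF assms(1)])
  qed (rule add)
qed

lemma hahn_banach_sublinear:
  fixes p :: "'a::real_vector \<Rightarrow> real"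
  assumes "sublinear p"
  obtains f where "linear f" "f \<le> p"
proof -
  let ?A = "{q. sublinear q \<and> q \<le> p}"
  \<comment> \<open>The order is reversed, so that the maximal element given by Zorn's lemma is a
    minimal functional.\<close>
  let ?R = "relation_of (\<lambda>a b. b \<le> a) ?A"
  have "\<exists>m\<in>?A. \<forall>a\<in>?A. a \<le> m \<longrightarrow> a = m"
  proof (rule predicate_Zorn)
    show "partial_order_on ?A ?R"
      by (rule partial_order_on_relation_ofI) auto
  next
    fix C assume C: "C \<in> Chains ?R"
    then have sub: "\<And>q. q \<in> C \<Longrightarrow> sublinear q \<and> q \<le> p"
      and chain: "\<And>q q'. q \<in> C \<Longrightarrow> q' \<in> C \<Longrightarrow> q \<le> q' \<or> q' \<le> q"
      by (auto simp: Chains_def relation_of_def)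
    show "\<exists>u\<in>?A. \<forall>a\<in>C. u \<le> a"
    proof (cases "C = {}")
      case True
      then show ?thesis using assms by auto
    next
      case False
      then obtain q0 where q0: "q0 \<in> C" by blast
      have bdd: "bdd_below ((\<lambda>q. q x) ` C)" for x
      proof (rule bdd_belowI2)
        fix q assume "q \<in> C"
        then have "- p (- x) \<le> - q (- x)" "- q (- x) \<le> q x"
          using sub sublinear_ge[of q x] by (auto simp: le_fun_def)
        then show "- p (- x) \<le> q x" by linarith
      qed
      let ?u = "\<lambda>x. INF q\<in>C. q x"
      have low: "?u \<le> q" if "q \<in> C" for q
        unfolding le_fun_def using cINF_lower[OF bdd that] by blast
      have "sublinear ?u"
        by (rule sublinear_INF_chain) (use False sub bdd chain in auto)
      moreover have "?u \<le> p" using low[OF q0] sub[OF q0] by (blast intro: order_trans)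
      ultimately show ?thesis using low by blast
    qed
  qed
  then obtain m where m: "sublinear m" "m \<le> p"
    and min: "\<And>a. sublinear a \<Longrightarrow> a \<le> p \<Longrightarrow> a \<le> m \<Longrightarrow> a = m" by blast
  have "linear m"
    by (rule minimal_sublinear_imp_linear) (use m min in \<open>auto intro: order_trans\<close>)
  with m(2) show thesis by (intro that)
qed

text \<open>Lowering the norm in direction \<open>z\<close> before extracting \<open>f\<close> gives
  \<open>f (- z) \<le> - norm z\<close>. Linearity turns this into \<open>norm z \<le> f z\<close>,
  and domination by the norm gives the converse.\<close>

lemma hahn_banach_norming_real:
  fixes z :: "'a::real_normed_vector"
  obtains f :: "'a \<Rightarrow> real" where "linear f" "\<And>x. f x \<le> norm x" "f z = norm z"
proof -
  obtain q :: "'a \<Rightarrow> real" where q: "sublinear q" "q \<le> norm" "\<And>x. q x \<le> norm (x + z) - norm z"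
    using sublinear_decrease[OF sublinear_norm] by metis
  obtain f where f: "linear f" "f \<le> q" using hahn_banach_sublinear[OF q(1)] .
  have le: "f x \<le> norm x" for x
    using f(2) q(2) by (metis le_funD order_trans)
  have "f (- z) \<le> q (- z)" using f(2) by (simp add: le_fun_def)
  also have "\<dots> \<le> - norm z" using q(3)[of "- z"] by simp
  finally have "f (- z) \<le> - norm z" .
  then have "f z = norm z" using le[of z] linear_neg[OF f(1), of z] by simp
  with f(1) le show thesis by (intro that)
qed

section \<open>Norming functionals over real or complex scalars\<close>

text \<open>The norm is only known to be multiplicative, so \<open>norm (h z) \<le> 2 * norm z\<close>
  is improved to \<open>norm (h z) \<le> norm z\<close> by passing to powers of \<open>z\<close>.\<close>

lemma norm_complex_embedding:
  fixes i :: "'k::real_normed_field"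
  assumes "i * i = - 1"
  shows "norm (of_real a + i * of_real b) = cmod (Complex a b)"
proof -
  define h :: "complex \<Rightarrow> 'k" where "h z = of_real (Re z) + i * of_real (Im z)" for z
  have mult: "h (w * z) = h w * h z" for w z
  proof -
    have "h w * h z = of_real (Re w * Re z) + (i * i) * of_real (Im w * Im z)
        + i * of_real (Re w * Im z + Im w * Re z)"
      by (simp add: h_def algebra_simps)
    then show ?thesis by (simp add: assms h_def algebra_simps)
  qed
  have one: "h 1 = 1" by (simp add: h_def)
  have power: "h (z ^ n) = h z ^ n" for z n
    by (induction n) (simp_all add: one mult)
  have "norm i * norm i = 1" using assms by (metis norm_minus_cancel norm_mult norm_one)
  then have norm_i: "norm i = 1"
    by (metis norm_ge_zero abs_of_nonneg abs_square_eq_1 power2_eq_square)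
  have bound: "norm (h z) \<le> 2 * cmod z" for z
  proof -
    have "norm (h z) \<le> \<bar>Re z\<bar> + \<bar>Im z\<bar>"
      unfolding h_def by (rule norm_triangle_le) (simp add: norm_mult norm_i)
    also have "\<dots> \<le> 2 * cmod z"
      using abs_Re_le_cmod[of z] abs_Im_le_cmod[of z] by linarith
    finally show ?thesis .
  qed
  have le: "norm (h z) \<le> cmod z" for z
  proof (cases "z = 0")
    case True
    then show ?thesis by (simp add: h_def)
  next
    case False
    show ?thesis
    proof (rule ccontr)
      assume "\<not> ?thesis"
      then have "1 < norm (h z) / cmod z" using False by simp
      then obtain n where "2 < (norm (h z) / cmod z) ^ n" using real_arch_pow by blast
      then have "2 * cmod (z ^ n) < norm (h (z ^ n))"
        using False by (simp add: field_simps norm_power power)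
      with bound[of "z ^ n"] show False by simp
    qed
  qed
  \<comment> \<open>The reverse bound comes from \<open>le\<close> at \<open>inverse z\<close>,
    because \<open>h\<close> is multiplicative.\<close>
  have "cmod z \<le> norm (h z)" for z
  proof (cases "z = 0")
    case False
    have "norm (h z) * norm (h (inverse z)) = 1"
      using mult[of z "inverse z"] False by (simp add: one flip: norm_mult)
    moreover have "norm (h z) * norm (h (inverse z)) \<le> norm (h z) * inverse (cmod z)"
      by (rule mult_left_mono) (use le[of "inverse z"] in \<open>simp_all add: norm_inverse\<close>)
    ultimately show ?thesis using False by (simp add: field_simps)
  qed simp
  then have "norm (h (Complex a b)) = cmod (Complex a b)" using le by (simp add: order_antisym)
  then show ?thesis by (simp add: h_def)
qed

lemma (in banach_space_over) hahn_banach_norming: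
  obtains \<phi> :: "'x \<Rightarrow> 'k" where "Vector_Spaces.linear scale (*) \<phi>"
    and "\<And>x. norm (\<phi> x) \<le> norm x" and "norm (\<phi> z) = norm z"
proof -
  obtain f :: "'x \<Rightarrow> real" where f: "linear f" "\<And>x. f x \<le> norm x" "f z = norm z"
    using hahn_banach_norming_real[of z] by blast
  have f_add: "f (x + y) = f x + f y" and f_scaleR: "f (r *\<^sub>R x) = r * f x" for x y r
    using linear_add[OF f(1)] linear_scale[OF f(1)] by auto
  have K: "vector_space ((*) :: 'k \<Rightarrow> 'k \<Rightarrow> 'k)"
    by unfold_locales (simp_all add: algebra_simps)
  have abs_f: "\<bar>f x\<bar> \<le> norm x" for x
    using f(2)[of x] f(2)[of "- x"] linear_neg[OF f(1), of x] by simp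
  from real_or_complex[where 'a = 'k] show thesis
  proof (elim disjE exE conjE)
    assume real: "\<forall>c::'k. \<exists>r. c = r *\<^sub>R 1"
    show thesis
    proof
      show "Vector_Spaces.linear scale (*) (\<lambda>x. of_real (f x))"
        unfolding Vector_Spaces.linear_iff
      proof (intro conjI allI)
        fix c :: 'k and x
        obtain r where "c = of_real r" using real unfolding of_real_def by blast
        then show "of_real (f (scale c x)) = c * of_real (f x)"
          by (simp add: scale_of_real f_scaleR)
      qed (simp_all add: vector_space_axioms K f_add)
    qed (simp_all add: abs_f f(3))
  next
    fix i :: 'k
    assume i: "i * i = - 1" and "\<forall>c. \<exists>a b. c = a *\<^sub>R 1 + b *\<^sub>R i"
    then have complex: "\<exists>a b. c = of_real a + i * of_real b" for c
      by (simp add: scaleR_conv_of_real mult.commute)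
    note norm_k = norm_complex_embedding[OF i]
    \<comment> \<open>If a complex-linear functional has real part \<open>f\<close>, compatibility
      with \<open>i\<close> forces its imaginary part at \<open>x\<close> to be
      \<open>- f (scale i x)\<close>.\<close>
    define \<phi> where "\<phi> x = of_real (f x) + i * of_real (- f (scale i x))" for x
    have scale_i: "\<phi> (scale i x) = i * \<phi> x" for x
    proof -
      have "scale i (scale i x) = - x" by (simp add: i)
      then show ?thesis
        using linear_neg[OF f(1), of x]
        by (simp add: \<phi>_def algebra_simps i flip: mult.assoc)
    qed
    have add: "\<phi> (x + y) = \<phi> x + \<phi> y" for x y
      by (simp add: \<phi>_def scale_right_distrib f_add algebra_simps)
    have of_real: "\<phi> (scale (of_real r) x) = of_real r * \<phi> x" for r x
      using f_scaleR[of r x] f_scaleR[of r "scale i x"] scale_left_commute[of i "of_real r" x]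
      by (simp add: \<phi>_def scale_of_real right_diff_distrib mult.left_commute del: scale_scale)
    \<comment> \<open>Scalars are real combinations of 1 and \<open>i\<close>, so additivity, real
      homogeneity and \<open>scale_i\<close> suffice.\<close>
    have mult: "\<phi> (scale c x) = c * \<phi> x" for c x
    proof -
      obtain a b where "c = of_real a + i * of_real b" using complex by blast
      then show ?thesis
        by (simp only: scale_left_distrib add of_real scale_i scale_scale[symmetric] algebra_simps)
    qed
    have le: "norm (\<phi> x) \<le> norm x" for x
    proof (cases "\<phi> x = 0")
      case False
      text \<open>Rotate \<open>x\<close> so that \<open>\<phi>\<close> becomes real there and hence agrees with \<open>f\<close>.\<close>
      define c where "c = of_real (norm (\<phi> x)) / \<phi> x"
      define y where "y = scale c x"
      have "norm c = 1" using False by (simp add: c_def norm_divide)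
      then have norm_y: "norm y = norm x" by (simp add: y_def norm_scale)
      have "\<phi> y = of_real (norm (\<phi> x))" using False by (simp add: y_def mult c_def)
      \<comment> \<open>Real and imaginary parts in \<open>'k\<close> are compared by moving the
        difference to the complex numbers through \<open>norm_k\<close>.\<close>
      then have "of_real (f y - norm (\<phi> x)) + i * of_real (- f (scale i y)) = 0"
        by (simp add: \<phi>_def[of y] algebra_simps)
      then have "cmod (Complex (f y - norm (\<phi> x)) (- f (scale i y))) = 0"
        using norm_k by (metis norm_zero)
      then have "f y = norm (\<phi> x)" by (simp add: complex_eq_iff)
      with f(2)[of y] norm_y show ?thesis by simp
    qed simp
    \<comment> \<open>The real part of \<open>\<phi> z\<close> is \<open>f z = norm z\<close>, and
      it cannot exceed the modulus.\<close>
    have "norm z \<le> norm (\<phi> z)"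
      using abs_Re_le_cmod[of "Complex (f z) (- f (scale i z))"] f(3) by (simp only: \<phi>_def norm_k) simp
    moreover have "Vector_Spaces.linear scale (*) \<phi>"
      unfolding Vector_Spaces.linear_iff
      by (simp add: vector_space_axioms K add mult)
    ultimately show thesis using that le by (meson order_antisym)
  qed
qed

section \<open>Rank-one operators and lineability\<close>

lemma ell_norm_eq_0D:
  assumes "a \<in> ell q" "ell_norm q a = 0"
  shows "a n = 0"
proof -
  have "(\<Sum>n. norm (a n) powr q) = 0" using assms(2) by (simp add: ell_norm_def)
  then have "norm (a n) powr q = 0"
    using assms(1) by (subst (asm) suminf_eq_zero_iff) (auto simp: ell_def)
  then show ?thesis by simp
qed

lemma ell_finite_support: "(\<And>k. n \<le> k \<Longrightarrow> a k = 0) \<Longrightarrow> a \<in> ell q"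
  unfolding ell_def mem_Collect_eq
  by (rule summable_finite[of "{..<n}"], auto simp: not_less)

lemma contains_ell_imp_infinite_dimensional:
  assumes "banach_space_over sY" "contains_isometric_copy_of_ell sY q"
  shows "infinite_dimensional sY UNIV"
proof -
  interpret Y: banach_space_over sY by fact
  obtain J where J_add: "\<And>a b. a \<in> ell q \<Longrightarrow> b \<in> ell q \<Longrightarrow> J (\<lambda>n. a n + b n) = J a + J b"
    and J_scale: "\<And>c a. a \<in> ell q \<Longrightarrow> J (\<lambda>n. c * a n) = sY c (J a)"
    and J_norm: "\<And>a. a \<in> ell q \<Longrightarrow> norm (J a) = ell_norm q a"
    using assms(2) unfolding contains_isometric_copy_of_ell_def by blast
  define F where "F n = {a :: nat \<Rightarrow> 'a. \<forall>k\<ge>n. a k = 0}" for n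
  define e where "e n = (\<lambda>k. if k = n then 1 else 0 :: 'a)" for n :: nat
  have F_ell: "a \<in> ell q" if "a \<in> F n" for a n
    using that by (intro ell_finite_support[of n]) (simp add: F_def)
  have e_F: "e m \<in> F n" if "m < n" for m n using that by (simp add: e_def F_def)
  have subspace: "Y.subspace (J ` F n)" for n
  proof (rule Y.subspaceI)
    have "(\<lambda>k. 0) \<in> F n" by (simp add: F_def)
    then have "J (\<lambda>k. 0) = 0" using J_scale[OF F_ell, of "\<lambda>k. 0" n 0] by simp
    with \<open>(\<lambda>k. 0) \<in> F n\<close> show "0 \<in> J ` F n" by force
    show "u + v \<in> J ` F n" if "u \<in> J ` F n" "v \<in> J ` F n" for u v
    proof -
      from that obtain a b where ab: "a \<in> F n" "b \<in> F n" "u = J a" "v = J b" by blast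
      then have "u + v = J (\<lambda>k. a k + b k)" using J_add F_ell by simp
      moreover have "(\<lambda>k. a k + b k) \<in> F n" using ab by (simp add: F_def)
      ultimately show ?thesis by blast
    qed
    show "sY c u \<in> J ` F n" if "u \<in> J ` F n" for c u
    proof -
      from that obtain a where a: "a \<in> F n" "u = J a" by blast
      then have "sY c u = J (\<lambda>k. c * a k)" using J_scale F_ell by simp
      moreover have "(\<lambda>k. c * a k) \<in> F n" using a by (simp add: F_def)
      ultimately show ?thesis by blast
    qed
  qed
  have notin: "J (e n) \<notin> Y.span ((\<lambda>m. J (e m)) ` {..<n})" for n
  proof
    assume "J (e n) \<in> Y.span ((\<lambda>m. J (e m)) ` {..<n})"
    moreover have "Y.span ((\<lambda>m. J (e m)) ` {..<n}) \<subseteq> J ` F n"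
      by (rule Y.span_minimal[OF _ subspace]) (use e_F in auto)
    ultimately obtain a where a: "a \<in> F n" "J (e n) = J a" by blast
    \<comment> \<open>The difference of \<open>e n\<close> and \<open>a\<close> is written with the
      factor -1 so that the linearity of \<open>J\<close> on \<open>ell q\<close> applies to it
      literally. Its entry at \<open>n\<close> is 1, as \<open>a\<close> vanishes there.\<close>
    define d where "d = (\<lambda>k. e n k + (- 1) * a k)"
    have "(\<lambda>k. (- 1) * a k) \<in> ell q"
      by (rule ell_finite_support[of n]) (use a in \<open>simp add: F_def\<close>)
    then have "J d = J (e n) + J (\<lambda>k. (- 1) * a k)"
      unfolding d_def by (rule J_add[OF F_ell[OF e_F[OF lessI]]])
    also have "\<dots> = J (e n) + sY (- 1) (J a)"
      by (simp only: J_scale[OF F_ell[OF a(1)]])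
    finally have J_d: "J d = J (e n) + sY (- 1) (J a)" .
    have d: "d \<in> ell q"
      by (rule ell_finite_support[of "Suc n"]) (use a in \<open>auto simp: d_def e_def F_def\<close>)
    have "ell_norm q d = 0" using a(2) J_norm[OF d] J_d by simp
    then have "d n = 0" by (rule ell_norm_eq_0D[OF d])
    then show False using a(1) by (simp add: d_def e_def F_def)
  qed
  \<comment> \<open>The cardinality is carried along because independence of the image set alone
    would not exclude coinciding vectors.\<close>
  have indep: "Y.independent ((\<lambda>m. J (e m)) ` {..<n}) \<and> card ((\<lambda>m. J (e m)) ` {..<n}) = n" for n
  proof (induction n)
    case (Suc n)
    then show ?case
      using notin[of n] Y.span_superset[of "(\<lambda>m. J (e m)) ` {..<n}"]
      by (auto simp: lessThan_Suc Y.independent_insert card_insert_if)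
  qed (simp add: Y.independent_empty)
  show ?thesis
    unfolding infinite_dimensional_def
  proof clarify
    fix B assume B: "finite B" "Y.span B = UNIV"
    show False
      using Y.independent_span_bound[OF B(1), of "(\<lambda>m. J (e m)) ` {..<Suc (card B)}"]
        indep[of "Suc (card B)"] B(2) by simp
  qed
qed

lemma infinite_dimensional_linear_image:
  assumes "Vector_Spaces.linear s1 s2 f" "infinite_dimensional s2 (f ` W)"
  shows "infinite_dimensional s1 W"
proof -
  interpret Vector_Spaces.linear s1 s2 f by fact
  show ?thesis
    using assms(2) span_image unfolding infinite_dimensional_def by (metis finite_imageI)
qed

theorem proposition6:
  fixes sX :: "'k::real_or_complex \<Rightarrow> 'x::banach \<Rightarrow> 'x"
    and sY :: "'k \<Rightarrow> 'y::banach \<Rightarrow> 'y"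
    and x0 :: 'x
  assumes "banach_space_over sX" and "banach_space_over sY"
    and "\<exists>q\<ge>1. contains_isometric_copy_of_ell sY q"
    and "norm x0 = 1"
  shows "lineable (blinfun_scale sY)
      (bounded_operators sX sY) (norm_attaining_at sX sY x0)"
proof -
  interpret X: banach_space_over sX by fact
  interpret Y: banach_space_over sY by fact
  interpret L: vector_space "blinfun_scale sY :: 'k \<Rightarrow> ('x \<Rightarrow>\<^sub>L 'y) \<Rightarrow> _"
    by (rule vector_space_blinfun_scale[OF assms(2)])
  obtain \<phi> where \<phi>: "Vector_Spaces.linear sX (*) \<phi>"
    and \<phi>_le: "\<And>x. norm (\<phi> x) \<le> norm x" and \<phi>_x0: "norm (\<phi> x0) = 1"
    using X.hahn_banach_norming[of x0] assms(4) by metis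
  have \<phi>_add: "\<phi> (x + y) = \<phi> x + \<phi> y" and \<phi>_scale: "\<phi> (sX c x) = c * \<phi> x" for x y c
    using \<phi> by (simp_all add: Vector_Spaces.linear_iff)
  define R where "R y = Blinfun (\<lambda>x. sY (\<phi> x) y)" for y
  have R: "blinfun_apply (R y) x = sY (\<phi> x) y" for x y
  proof -
    have "bounded_linear (\<lambda>x. sY (\<phi> x) y)"
    proof (rule bounded_linear_intro[where K = "norm y"])
      show "sY (\<phi> (r *\<^sub>R x)) y = r *\<^sub>R sY (\<phi> x) y" for r x
        by (simp add: \<phi>_scale flip: X.scale_of_real Y.scale_of_real)
      show "norm (sY (\<phi> x) y) \<le> norm x * norm y" for x
        by (simp add: Y.norm_scale mult_right_mono \<phi>_le)
    qed (simp add: \<phi>_add Y.scale_left_distrib)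
    then show ?thesis by (simp add: R_def bounded_linear_Blinfun_apply)
  qed
  have attain: "R y \<in> norm_attaining_at sX sY x0" for y
  proof -
    \<comment> \<open>The estimates close up: \<open>norm (R y)\<close> is at most
      \<open>norm y\<close>, which is the norm of the value at \<open>x0\<close>, which is at most
      \<open>norm (R y)\<close>.\<close>
    have "norm (R y) \<le> norm y"
      by (rule norm_blinfun_bound) (simp_all add: R Y.norm_scale mult_right_mono \<phi>_le mult.commute[of "norm y"])
    moreover have "norm (blinfun_apply (R y) x0) = norm y"
      by (simp add: R Y.norm_scale \<phi>_x0)
    moreover have "norm (blinfun_apply (R y) x0) \<le> norm (R y)"
      using norm_blinfun[of "R y" x0] assms(4) by simp
    moreover have "R y \<in> bounded_operators sX sY"
      by (simp add: bounded_operators_def Vector_Spaces.linear_iff X.vector_space_axioms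
          Y.vector_space_axioms R \<phi>_add \<phi>_scale Y.scale_left_distrib)
    ultimately show ?thesis by (simp add: norm_attaining_at_def)
  qed
  have subspace: "L.subspace (range R)"
  proof (rule L.subspaceI)
    have "0 = R 0" by (rule blinfun_eqI) (simp add: R)
    then show "0 \<in> range R" by blast
    have "R u + R v = R (u + v)" for u v
      by (rule blinfun_eqI) (simp add: R blinfun.add_left Y.scale_right_distrib)
    then show "S + T \<in> range R" if "S \<in> range R" "T \<in> range R" for S T
      using that by auto
    have "blinfun_scale sY c (R u) = R (sY c u)" for c u
      by (rule blinfun_eqI)
        (simp add: R blinfun_apply_blinfun_scale[OF assms(2)] mult.commute)
    then show "blinfun_scale sY c T \<in> range R" if "T \<in> range R" for c T
      using that by auto
  qed
  \<comment> \<open>Evaluation at \<open>x0\<close> maps \<open>range R\<close> onto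
    \<open>'y\<close>: the factor \<open>inverse (\<phi> x0)\<close> cancels the scalar
    \<open>\<phi> x0\<close>, which need not be 1. Infinite dimension thus passes back from
    \<open>'y\<close> to \<open>range R\<close>.\<close>
  let ?ev = "\<lambda>T :: 'x \<Rightarrow>\<^sub>L 'y. blinfun_apply T x0"
  have ev: "Vector_Spaces.linear (blinfun_scale sY) sY ?ev"
    by (simp add: Vector_Spaces.linear_iff L.vector_space_axioms Y.vector_space_axioms
        blinfun.add_left blinfun_apply_blinfun_scale[OF assms(2)])
  have "\<phi> x0 \<noteq> 0" using \<phi>_x0 by auto
  then have "?ev (R (sY (inverse (\<phi> x0)) y)) = y" for y
    by (simp add: R)
  then have "?ev ` range R = UNIV" by (metis (no_types) image_eqI rangeI UNIV_eq_I)
  moreover have "infinite_dimensional sY UNIV"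
    using contains_ell_imp_infinite_dimensional[OF assms(2)] assms(3) by blast
  ultimately have "infinite_dimensional (blinfun_scale sY) (range R)"
    using infinite_dimensional_linear_image[OF ev] by simp
  then show ?thesis
    unfolding lineable_def
    using L.vector_space_axioms subspace_bounded_operators[OF assms(1,2)] subspace attain
    by (auto simp: norm_attaining_at_def)
qed

end
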